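(* Let $V$ be a finite set of Boolean variables, let $\circ\in\{\wedge,\vee\}$, and suppose all formulas occurring on the left- and right-hand sides below are DQBFs in $\mathcal{D}$ over $V$ (as defined in the context). Let $x'$ and $y'$ be fresh variables not occurring in $\varphi,\varphi_1,\varphi_2$. Then: (a) $\exists y(D_y):\varphi\ \equiv\ \varphi$; (b) $\forall x:\varphi\ \approx\ \varphi^{-x}$ if $x\notin V_\varphi$; (c) $\forall x:\varphi\ \equiv\ \varphi[0/x]\wedge\varphi[1/x]$ if $V^\forall_\varphi=V^\exists_\varphi=\emptyset$; (d) $\exists y(D_y):\varphi\ \approx\ \varphi[0/y]\vee\varphi[1/y]$ if $V^\forall_\varphi=V^\exists_\varphi=\emptyset$; (e) $\forall x:(\varphi_1\wedge\varphi_2)\ \approx\ (\forall x:\varphi_1)\wedge(\forall x':\varphi_2[x'/x])$, where $\varphi_2[x'/x]$ replaces all occurrences of $x$ by $x'$, including occurrences in dependency sets; (f) $\forall x:(\varphi_1\wedge\varphi_2)\ \approx\ (\varphi_1^{-x}\wedge(\forall x:\varphi_2))$ if $x\notin V_{\varphi_1}$; (g) $\forall x:(\varphi_1\circ\varphi_2)\ \equiv\ (\varphi_1\circ(\forall x:\varphi_2))$ if $x\notin V_{\varphi_1}$ and $x\notin D_y$ for all $y\in V^\exists_{\varphi_1}$; (h) $\exists y(D_y):(\varphi_1\vee\varphi_2)\ \approx\ (\exists y(D_y):\varphi_1)\vee(\exists y'(D_y):\varphi_2[y'/y])$; (i) $\exists y(D_y):(\varphi_1\circ\varphi_2)\ \equiv\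 (\varphi_1\circ(\exists y(D_y):\varphi_2))$ if $y\notin V_{\varphi_1}$; (j) $\exists y_1(D_{y_1})\,\exists y_2(D_{y_2}):\varphi\ \equiv\ \exists y_2(D_{y_2})\,\exists y_1(D_{y_1}):\varphi$; (k) $\forall x_1\,\forall x_2:\varphi\ \equiv\ \forall x_2\,\forall x_1:\varphi$; (l) $\forall x\,\exists y(D_y):\varphi\ \equiv\ \exists y(D_y)\,\forall x:\varphi$ if $x\notin D_y$.
   Context: Notation: for a set $W$ of Boolean variables, $\mathcal{F}(W)$ is the set of Boolean functions on assignments $W\to\{0,1\}$; $\mathrm{supp}(f)$ is the set of variables on which $f$ actually depends; $\mathbf{0},\mathbf{1}$ are constant functions; $\varphi[\kappa/v]$ denotes simultaneous replacement of $v$ by $\kappa$ in $\varphi$. Syntax (non-closed non-prenex DQBFs in NNF over a finite variable set $V$). The set $\mathcal{D}$, together with for each $\psi$ the sets $V^{\exists}_\psi$ (existential), $V^{\forall}_\psi$ (universal), $V^{\mathrm{fs}}_\psi$ (free variables occurring in $\psi$), and a dependency set $D_y\subseteq V$ for each existential variable $y$, is the smallest set closed under: (1) $v\in\mathcal{D}$ for $v\in V$, with $V^\exists=V^\forall=\emptyset$, $V^{\mathrm{fs}}=\{v\}$; (2) $\neg v\in\mathcal{D}$, same sets; (3),(4) if $\varphi_1,\varphi_2\in\mathcal{D}$ and $\bigl(V^Q_{\varphi_1}\cup V^{\mathrm{fs}}_{\varphi_1}\cup\bigcup_{y\in V^\exists_{\varphi_1}}D_y\bigr)\cap V^Q_{\varphi_2}=\emptyset$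 and symmetrically with $1,2$ swapped, then $(\varphi_1\wedge\varphi_2),(\varphi_1\vee\varphi_2)\in\mathcal{D}$ with $V^\exists$, $V^\forall$, $V^{\mathrm{fs}}$ the unions of those of the parts; (5) if $\varphi\in\mathcal{D}$, $v\in V^{\mathrm{free}}_\varphi$, $D_v\subseteq V\setminus(V^Q_\varphi\cup\{v\})$, then $\exists v(D_v):\varphi^{-v}\in\mathcal{D}$, where $\varphi^{-v}$ is $\varphi$ with $v$ removed from the dependency sets of all its existential variables; $V^\exists=V^\exists_\varphi\cup\{v\}$, $V^\forall=V^\forall_\varphi$, $V^{\mathrm{fs}}=V^{\mathrm{fs}}_\varphi\setminus\{v\}$; (6) if $\varphi\in\mathcal{D}$, $v\in V^{\mathrm{free}}_\varphi$, then $\forall v:\varphi\in\mathcal{D}$ with $V^\forall=V^\forall_\varphi\cup\{v\}$, $V^\exists=V^\exists_\varphi$, $V^{\mathrm{fs}}=V^{\mathrm{fs}}_\varphi\setminus\{v\}$. Here $V^Q_\psi=V^\exists_\psi\cup V^\forall_\psi$, $V_\psi=V^Q_\psi\cup V^{\mathrm{fs}}_\psi$, $V^{\mathrm{free}}_\psi=V\setminus V^Q_\psi$. Semantics. A Skolem function candidate for $\psi$ is a map $s:V^{\mathrm{free}}_\psi\cup V^\exists_\psi\to\mathcal{F}(V^\forall_\psi)$ with $s(v)$ constant for free $v$ and $\mathrm{supp}(s(v))\subseteq D_v\cap V^\forall_\psi$ for existential $v$; $\mathcal{S}_\psi$ is the set of these. $s(\psi)$ is obtained by replacing each $v$ in the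 domain of $s$ by $s(v)$ and deleting all quantifiers. $[\![\psi]\!]=\{s\in\mathcal{S}_\psi\mid s(\psi)\text{ is a tautology}\}$; $\psi$ is satisfiable iff $[\![\psi]\!]\neq\emptyset$. Two DQBFs are equivalent ($\psi_1\equiv\psi_2$) if $[\![\psi_1]\!]=[\![\psi_2]\!]$, and equisatisfiable ($\psi_1\approx\psi_2$) if $[\![\psi_1]\!]=\emptyset\iff[\![\psi_2]\!]=\emptyset$.
   Formalization: In (c) the two sides have Skolem candidates with different domains (V\{x} and V), so ≡ as set equality fails; it is proved as equality up to restriction to V\{x}. In (c),(d) the right sides may contain the constants 0,1, which rules (1)-(6) do not admit in D. *)

theory Defs
  imports Main
begin

text \<open>Constants are needed as atoms because \<open>\<phi>[0/x]\<close> and \<open>\<phi>[1/x]\<close> contain them; the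
  DQBFs proper (\<open>dqbfs\<close> below) are constant-free.\<close>

datatype 'v atom = Var 'v | Const bool

datatype 'v dqbf =
    Pos "'v atom"
  | Neg "'v atom"
  | Conj "'v dqbf" "'v dqbf"
  | Disj "'v dqbf" "'v dqbf"
  | Exists 'v "'v set" "'v dqbf"
  | Forall 'v "'v dqbf"

fun atom_vars :: "'v atom \<Rightarrow> 'v set" where
  "atom_vars (Var v) = {v}"
| "atom_vars (Const b) = {}"

fun ex_vars :: "'v dqbf \<Rightarrow> 'v set" where
  "ex_vars (Pos a) = {}"
| "ex_vars (Neg a) = {}"
| "ex_vars (Conj \<phi> \<psi>) = ex_vars \<phi> \<union> ex_vars \<psi>"
| "ex_vars (Disj \<phi> \<psi>) = ex_vars \<phi> \<union> ex_vars \<psi>"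
| "ex_vars (Exists v D \<phi>) = ex_vars \<phi> \<union> {v}"
| "ex_vars (Forall v \<phi>) = ex_vars \<phi>"

fun all_vars :: "'v dqbf \<Rightarrow> 'v set" where
  "all_vars (Pos a) = {}"
| "all_vars (Neg a) = {}"
| "all_vars (Conj \<phi> \<psi>) = all_vars \<phi> \<union> all_vars \<psi>"
| "all_vars (Disj \<phi> \<psi>) = all_vars \<phi> \<union> all_vars \<psi>"
| "all_vars (Exists v D \<phi>) = all_vars \<phi>"
| "all_vars (Forall v \<phi>) = all_vars \<phi> \<union> {v}"

fun fs_vars :: "'v dqbf \<Rightarrow> 'v set" where
  "fs_vars (Pos a) = atom_vars a"
| "fs_vars (Neg a) = atom_vars a"
| "fs_vars (Conj \<phi> \<psi>) = fs_vars \<phi> \<union> fs_vars \<psi>"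
| "fs_vars (Disj \<phi> \<psi>) = fs_vars \<phi> \<union> fs_vars \<psi>"
| "fs_vars (Exists v D \<phi>) = fs_vars \<phi> - {v}"
| "fs_vars (Forall v \<phi>) = fs_vars \<phi> - {v}"

definition q_vars :: "'v dqbf \<Rightarrow> 'v set" where
  "q_vars \<psi> = ex_vars \<psi> \<union> all_vars \<psi>"

definition vars :: "'v dqbf \<Rightarrow> 'v set" where
  "vars \<psi> = q_vars \<psi> \<union> fs_vars \<psi>"

definition free_vars :: "'v set \<Rightarrow> 'v dqbf \<Rightarrow> 'v set" where
  "free_vars V \<psi> = V - q_vars \<psi>"

text \<open>\<open>dep \<psi> y\<close> is the dependency set \<open>D\<^sub>y\<close> in \<open>\<psi>\<close>. In a DQBF every variable is quantified at
  most once, so the unions have at most one non-empty argument.\<close>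

fun dep :: "'v dqbf \<Rightarrow> 'v \<Rightarrow> 'v set" where
  "dep (Pos a) y = {}"
| "dep (Neg a) y = {}"
| "dep (Conj \<phi> \<psi>) y = dep \<phi> y \<union> dep \<psi> y"
| "dep (Disj \<phi> \<psi>) y = dep \<phi> y \<union> dep \<psi> y"
| "dep (Exists v D \<phi>) y = (if y = v then D else dep \<phi> y)"
| "dep (Forall v \<phi>) y = dep \<phi> y"

definition dep_vars :: "'v dqbf \<Rightarrow> 'v set" where
  "dep_vars \<psi> = (\<Union>y\<in>ex_vars \<psi>. dep \<psi> y)"

definition occurs :: "'v \<Rightarrow> 'v dqbf \<Rightarrow> bool" where
  "occurs v \<psi> \<longleftrightarrow> v \<in> vars \<psi> \<union> dep_vars \<psi>"

text \<open>\<open>remove_dep v \<phi>\<close> is \<open>\<phi>\<close> with \<open>v\<close> deleted from all dependency sets (\<open>\<phi>\<close> with superscript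
  \<open>-v\<close>).\<close>

fun remove_dep :: "'v \<Rightarrow> 'v dqbf \<Rightarrow> 'v dqbf" where
  "remove_dep v (Pos a) = Pos a"
| "remove_dep v (Neg a) = Neg a"
| "remove_dep v (Conj \<phi> \<psi>) = Conj (remove_dep v \<phi>) (remove_dep v \<psi>)"
| "remove_dep v (Disj \<phi> \<psi>) = Disj (remove_dep v \<phi>) (remove_dep v \<psi>)"
| "remove_dep v (Exists w D \<phi>) = Exists w (D - {v}) (remove_dep v \<phi>)"
| "remove_dep v (Forall w \<phi>) = Forall w (remove_dep v \<phi>)"

inductive_set dqbfs :: "'v set \<Rightarrow> 'v dqbf set" for V :: "'v set" where
  pos: "v \<in> V \<Longrightarrow> Pos (Var v) \<in> dqbfs V"
| neg: "v \<in> V \<Longrightarrow> Neg (Var v) \<in> dqbfs V"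
| conj: "\<lbrakk>\<phi>\<^sub>1 \<in> dqbfs V; \<phi>\<^sub>2 \<in> dqbfs V;
    (q_vars \<phi>\<^sub>1 \<union> fs_vars \<phi>\<^sub>1 \<union> dep_vars \<phi>\<^sub>1) \<inter> q_vars \<phi>\<^sub>2 = {};
    (q_vars \<phi>\<^sub>2 \<union> fs_vars \<phi>\<^sub>2 \<union> dep_vars \<phi>\<^sub>2) \<inter> q_vars \<phi>\<^sub>1 = {}\<rbrakk>
    \<Longrightarrow> Conj \<phi>\<^sub>1 \<phi>\<^sub>2 \<in> dqbfs V"
| disj: "\<lbrakk>\<phi>\<^sub>1 \<in> dqbfs V; \<phi>\<^sub>2 \<in> dqbfs V;
    (q_vars \<phi>\<^sub>1 \<union> fs_vars \<phi>\<^sub>1 \<union> dep_vars \<phi>\<^sub>1) \<inter> q_vars \<phi>\<^sub>2 = {};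
    (q_vars \<phi>\<^sub>2 \<union> fs_vars \<phi>\<^sub>2 \<union> dep_vars \<phi>\<^sub>2) \<inter> q_vars \<phi>\<^sub>1 = {}\<rbrakk>
    \<Longrightarrow> Disj \<phi>\<^sub>1 \<phi>\<^sub>2 \<in> dqbfs V"
| ex: "\<lbrakk>\<phi> \<in> dqbfs V; v \<in> free_vars V \<phi>; D \<subseteq> V - (q_vars \<phi> \<union> {v})\<rbrakk>
    \<Longrightarrow> Exists v D (remove_dep v \<phi>) \<in> dqbfs V"
| all: "\<lbrakk>\<phi> \<in> dqbfs V; v \<in> free_vars V \<phi>\<rbrakk> \<Longrightarrow> Forall v \<phi> \<in> dqbfs V"

fun subst_atom :: "'v atom \<Rightarrow> 'v atom \<Rightarrow> 'v \<Rightarrow> 'v atom" where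
  "subst_atom (Var w) \<kappa> v = (if w = v then \<kappa> else Var w)"
| "subst_atom (Const b) \<kappa> v = Const b"

text \<open>\<open>subst \<phi> \<kappa> v\<close> is \<open>\<phi>[\<kappa>/v]\<close>, acting on dependency sets as well. It is meant for variables
  \<open>v\<close> that are not quantified in \<open>\<phi>\<close>, hence binders are left alone.\<close>

fun subst :: "'v dqbf \<Rightarrow> 'v atom \<Rightarrow> 'v \<Rightarrow> 'v dqbf" where
  "subst (Pos a) \<kappa> v = Pos (subst_atom a \<kappa> v)"
| "subst (Neg a) \<kappa> v = Neg (subst_atom a \<kappa> v)"
| "subst (Conj \<phi> \<psi>) \<kappa> v = Conj (subst \<phi> \<kappa> v) (subst \<psi> \<kappa> v)"
| "subst (Disj \<phi> \<psi>) \<kappa> v = Disj (subst \<phi> \<kappa> v) (subst \<psi> \<kappa> v)"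
| "subst (Exists w D \<phi>) \<kappa> v =
    Exists w (if v \<in> D then D - {v} \<union> atom_vars \<kappa> else D) (subst \<phi> \<kappa> v)"
| "subst (Forall w \<phi>) \<kappa> v = Forall w (subst \<phi> \<kappa> v)"

text \<open>A Boolean function over \<open>W\<close> is represented as a function of total assignments that only
  looks at \<open>W\<close>. Thus functions over \<open>W\<close> are also functions over any larger set.\<close>

type_synonym 'v boolfun = "('v \<Rightarrow> bool) \<Rightarrow> bool"

definition boolfuns :: "'v set \<Rightarrow> 'v boolfun set" where
  "boolfuns W = {f. \<forall>a b. (\<forall>v\<in>W. a v = b v) \<longrightarrow> f a = f b}"

definition supp :: "'v boolfun \<Rightarrow> 'v set" where
  "supp f = {v. \<exists>a. f (a(v := True)) \<noteq> f (a(v := False))}"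

definition constant_fun :: "'v boolfun \<Rightarrow> bool" where
  "constant_fun f \<longleftrightarrow> (\<exists>b. f = (\<lambda>_. b))"

type_synonym 'v skolem = "'v \<rightharpoonup> 'v boolfun"

definition skolem_dom :: "'v set \<Rightarrow> 'v dqbf \<Rightarrow> 'v set" where
  "skolem_dom V \<psi> = free_vars V \<psi> \<union> ex_vars \<psi>"

definition skolem_candidates :: "'v set \<Rightarrow> 'v dqbf \<Rightarrow> 'v skolem set" where
  "skolem_candidates V \<psi> = {s. dom s = skolem_dom V \<psi> \<and> ran s \<subseteq> boolfuns (all_vars \<psi>) \<and>
     (\<forall>v\<in>free_vars V \<psi>. constant_fun (the (s v))) \<and>
     (\<forall>v\<in>ex_vars \<psi>. supp (the (s v)) \<subseteq> dep \<psi> v \<inter> all_vars \<psi>)}"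

text \<open>\<open>inst s \<psi>\<close> is the Boolean function denoted by \<open>s(\<psi>)\<close>: variables in the domain of \<open>s\<close> are
  replaced by their Skolem functions and quantifiers are dropped.\<close>

fun inst_atom :: "'v skolem \<Rightarrow> 'v atom \<Rightarrow> 'v boolfun" where
  "inst_atom s (Var v) = (case s v of Some f \<Rightarrow> f | None \<Rightarrow> (\<lambda>a. a v))"
| "inst_atom s (Const b) = (\<lambda>a. b)"

fun inst :: "'v skolem \<Rightarrow> 'v dqbf \<Rightarrow> 'v boolfun" where
  "inst s (Pos l) = inst_atom s l"
| "inst s (Neg l) = (\<lambda>a. \<not> inst_atom s l a)"
| "inst s (Conj \<phi> \<psi>) = (\<lambda>a. inst s \<phi> a \<and> inst s \<psi> a)"
| "inst s (Disj \<phi> \<psi>) = (\<lambda>a. inst s \<phi> a \<or> inst s \<psi> a)"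
| "inst s (Exists v D \<phi>) = inst s \<phi>"
| "inst s (Forall v \<phi>) = inst s \<phi>"

definition tautology :: "'v boolfun \<Rightarrow> bool" where
  "tautology f \<longleftrightarrow> (\<forall>a. f a)"

definition sem :: "'v set \<Rightarrow> 'v dqbf \<Rightarrow> 'v skolem set" where
  "sem V \<psi> = {s \<in> skolem_candidates V \<psi>. tautology (inst s \<psi>)}"

definition equivalent :: "'v set \<Rightarrow> 'v dqbf \<Rightarrow> 'v dqbf \<Rightarrow> bool" where
  "equivalent V \<psi>\<^sub>1 \<psi>\<^sub>2 \<longleftrightarrow> sem V \<psi>\<^sub>1 = sem V \<psi>\<^sub>2"

definition equisatisfiable :: "'v set \<Rightarrow> 'v dqbf \<Rightarrow> 'v dqbf \<Rightarrow> bool" where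
  "equisatisfiable V \<psi>\<^sub>1 \<psi>\<^sub>2 \<longleftrightarrow> (sem V \<psi>\<^sub>1 = {} \<longleftrightarrow> sem V \<psi>\<^sub>2 = {})"

text \<open>Formulas whose Skolem candidates have different domains cannot be \<open>equivalent\<close>, unless
  both are unsatisfiable. This affects \<open>\<forall>x: \<phi>\<close> and \<open>\<phi>[0/x] \<and> \<phi>[1/x]\<close>: the variable \<open>x\<close> is
  universal in the former, but a (non-occurring) free variable of the latter, whose Skolem
  candidates therefore carry an irrelevant value for \<open>x\<close>. The relation \<open>equivalent_common\<close>
  compares Skolem functions on the common part of the domains: a candidate of either formula
  belongs to its semantics iff it agrees on the common domain with an element of the semantics
  of the other one. For equal domains this is \<open>equivalent\<close>.\<close>

definition equivalent_common :: "'v set \<Rightarrow> 'v dqbf \<Rightarrow> 'v dqbf \<Rightarrow> bool" where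
  "equivalent_common V \<psi>\<^sub>1 \<psi>\<^sub>2 \<longleftrightarrow>
    (let A = skolem_dom V \<psi>\<^sub>1 \<inter> skolem_dom V \<psi>\<^sub>2 in
      sem V \<psi>\<^sub>1 = {s \<in> skolem_candidates V \<psi>\<^sub>1. \<exists>t\<in>sem V \<psi>\<^sub>2. s |` A = t |` A} \<and>
      sem V \<psi>\<^sub>2 = {t \<in> skolem_candidates V \<psi>\<^sub>2. \<exists>s\<in>sem V \<psi>\<^sub>1. s |` A = t |` A})"

lemma sem_disjoint:
  assumes "skolem_dom V \<psi>\<^sub>1 \<noteq> skolem_dom V \<psi>\<^sub>2"
  shows "sem V \<psi>\<^sub>1 \<inter> sem V \<psi>\<^sub>2 = {}"
  using assms by (auto simp: sem_def skolem_candidates_def)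

lemma q_vars_subst: "q_vars (subst \<phi> \<kappa> v) = q_vars \<phi>"
proof -
  have "ex_vars (subst \<phi> \<kappa> v) = ex_vars \<phi>" "all_vars (subst \<phi> \<kappa> v) = all_vars \<phi>"
    by (induction \<phi>) auto
  then show ?thesis by (simp add: q_vars_def)
qed

lemma sem_expansion_disjoint:
  assumes "x \<in> V" "q_vars \<phi> = {}"
  shows "sem V (Forall x \<phi>) \<inter>
    sem V (Conj (subst \<phi> (Const False) x) (subst \<phi> (Const True) x)) = {}"
proof (rule sem_disjoint)
  have "x \<notin> skolem_dom V (Forall x \<phi>)"
    using assms by (auto simp: skolem_dom_def free_vars_def q_vars_def)
  moreover have "x \<in> skolem_dom V (Conj (subst \<phi> (Const False) x) (subst \<phi> (Const True) x))"
    using assms q_vars_subst[of \<phi> _ x] by (auto simp: skolem_dom_def free_vars_def q_vars_def)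
  ultimately show "skolem_dom V (Forall x \<phi>) \<noteq>
      skolem_dom V (Conj (subst \<phi> (Const False) x) (subst \<phi> (Const True) x))"
    by blast
qed

lemma equivalent_common_iff_equivalent:
  assumes "skolem_dom V \<psi>\<^sub>1 = skolem_dom V \<psi>\<^sub>2"
  shows "equivalent_common V \<psi>\<^sub>1 \<psi>\<^sub>2 \<longleftrightarrow> equivalent V \<psi>\<^sub>1 \<psi>\<^sub>2"
proof -
  let ?A = "skolem_dom V \<psi>\<^sub>2" and ?S1 = "skolem_candidates V \<psi>\<^sub>1" and ?S2 = "skolem_candidates V \<psi>\<^sub>2"
  have restr: "s |` ?A = s" if "s \<in> ?S1 \<union> ?S2" for s
  proof -
    have "dom s = ?A" using that assms by (auto simp: skolem_candidates_def)
    then show ?thesis by (metis domIff ext restrict_map_def)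
  qed
  have sub: "sem V \<psi>\<^sub>1 \<subseteq> ?S1" "sem V \<psi>\<^sub>2 \<subseteq> ?S2"
    by (auto simp: sem_def)
  have "(\<exists>t\<in>sem V \<psi>\<^sub>2. s |` ?A = t |` ?A) \<longleftrightarrow> s \<in> sem V \<psi>\<^sub>2" if "s \<in> ?S1" for s
    using that sub(2) restr by (metis UnCI subsetD)
  moreover have "(\<exists>s\<in>sem V \<psi>\<^sub>1. s |` ?A = t |` ?A) \<longleftrightarrow> t \<in> sem V \<psi>\<^sub>1" if "t \<in> ?S2" for t
    using that sub(1) restr by (metis UnCI subsetD)
  ultimately have
    "{s \<in> ?S1. \<exists>t\<in>sem V \<psi>\<^sub>2. s |` ?A = t |` ?A} = {s \<in> ?S1. s \<in> sem V \<psi>\<^sub>2}"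
    "{t \<in> ?S2. \<exists>s\<in>sem V \<psi>\<^sub>1. s |` ?A = t |` ?A} = {t \<in> ?S2. t \<in> sem V \<psi>\<^sub>1}"
    by blast+
  then have "equivalent_common V \<psi>\<^sub>1 \<psi>\<^sub>2 \<longleftrightarrow>
      sem V \<psi>\<^sub>1 = {s \<in> ?S1. s \<in> sem V \<psi>\<^sub>2} \<and> sem V \<psi>\<^sub>2 = {t \<in> ?S2. t \<in> sem V \<psi>\<^sub>1}"
    unfolding equivalent_common_def Let_def assms Int_absorb by (simp only:)
  then show ?thesis
    unfolding equivalent_def using sub by blast
qed

end

theory Submission
  imports Defs
begin

text \<open>The Boolean function \<open>s(\<psi>)\<close> is the matrix of \<open>\<psi>\<close> evaluated at the assignment that \<open>s\<close>
  induces, and a Skolem function candidate is just a family of functions of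
  \<open>D\<^sub>v \<inter> V\<^sup>\<forall>\<close>, where \<open>D\<^sub>v = {}\<close> for free \<open>v\<close>. Hence the semantics only depends on the prefix
  data and the matrix, and the rules that move a quantifier without duplicating it or changing
  a dependency set preserve both. In the other rules, Skolem functions are transported by fixing
  or renaming a variable of the assignment. A variable \<open>y\<close> quantified outermost by \<open>\<exists>y(D)\<close> has a
  constant Skolem function, because \<open>D\<close> contains no variable quantified inside.\<close>

section \<open>The matrix and the assignment induced by a Skolem function candidate\<close>

text \<open>The empty map has no Skolem function to insert, so every variable is read from the
  assignment itself.\<close>

abbreviation matrix :: "'v dqbf \<Rightarrow> 'v boolfun" where
  "matrix \<equiv> inst Map.empty"

definition extend :: "'v skolem \<Rightarrow> ('v \<Rightarrow> bool) \<Rightarrow> 'v \<Rightarrow> bool" where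
  "extend s a v = (case s v of Some f \<Rightarrow> f a | None \<Rightarrow> a v)"

text \<open>Inserting functions and then evaluating is the same as evaluating at the values of those
  functions. Later arguments therefore only compare assignments.\<close>

lemma inst_eq_matrix: "inst s \<psi> a = matrix \<psi> (extend s a)"
proof -
  have "inst_atom s l a = inst_atom Map.empty l (extend s a)" for l
    by (cases l) (auto simp: extend_def split: option.splits)
  then show ?thesis
    by (induction \<psi>) auto
qed

lemma vars_simps [simp]:
  "vars (Pos l) = atom_vars l" "vars (Neg l) = atom_vars l"
  "vars (Conj \<phi>\<^sub>1 \<phi>\<^sub>2) = vars \<phi>\<^sub>1 \<union> vars \<phi>\<^sub>2"
  "vars (Disj \<phi>\<^sub>1 \<phi>\<^sub>2) = vars \<phi>\<^sub>1 \<union> vars \<phi>\<^sub>2"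
  "vars (Exists v D \<phi>) = insert v (vars \<phi>)"
  "vars (Forall v \<phi>) = insert v (vars \<phi>)"
  by (auto simp: vars_def q_vars_def)

text \<open>The range is \<open>vars\<close>, not \<open>fs_vars\<close>: once the quantifiers are
  dropped, the matrix reads quantified variables too.\<close>

lemma matrix_cong:
  assumes "\<And>v. v \<in> vars \<psi> \<Longrightarrow> a v = b v"
  shows "matrix \<psi> a = matrix \<psi> b"
proof -
  have atom: "inst_atom Map.empty l a = inst_atom Map.empty l b"
    if "\<forall>v\<in>atom_vars l. a v = b v" for l
    using that by (cases l) auto
  have "\<forall>v\<in>vars \<psi>. a v = b v" using assms by blast
  then show ?thesis
    by (induction \<psi>) (use atom in auto)
qed

lemma matrix_remove_dep [simp]: "matrix (remove_dep x \<psi>) = matrix \<psi>"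
  by (induction \<psi>) auto

text \<open>Covers bound and free \<open>x\<close> alike, because \<open>subst\<close> leaves
  binders alone and the matrix does not see them.\<close>

lemma matrix_subst:
  "matrix (subst \<psi> \<kappa> x) a = matrix \<psi> (a(x := inst_atom Map.empty \<kappa> a))"
proof -
  have "inst_atom Map.empty (subst_atom l \<kappa> x) a
      = inst_atom Map.empty l (a(x := inst_atom Map.empty \<kappa> a))" for l
    by (cases l) auto
  then show ?thesis by (induction \<psi>) auto
qed

section \<open>Prefix data under \<open>remove_dep\<close> and \<open>subst\<close>\<close>

lemma ex_vars_remove_dep [simp]: "ex_vars (remove_dep x \<psi>) = ex_vars \<psi>"
  by (induction \<psi>) auto

lemma all_vars_remove_dep [simp]: "all_vars (remove_dep x \<psi>) = all_vars \<psi>"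
  by (induction \<psi>) auto

lemma q_vars_remove_dep [simp]: "q_vars (remove_dep x \<psi>) = q_vars \<psi>"
  by (simp add: q_vars_def)

lemma fs_vars_remove_dep [simp]: "fs_vars (remove_dep x \<psi>) = fs_vars \<psi>"
  by (induction \<psi>) auto

lemma vars_remove_dep [simp]: "vars (remove_dep x \<psi>) = vars \<psi>"
  by (simp add: vars_def)

lemma dep_remove_dep [simp]: "dep (remove_dep x \<psi>) v = dep \<psi> v - {x}"
  by (induction \<psi>) auto

lemma dep_vars_remove_dep [simp]: "dep_vars (remove_dep x \<psi>) = dep_vars \<psi> - {x}"
  by (auto simp: dep_vars_def)

lemma remove_dep_commute: "remove_dep x (remove_dep y \<psi>) = remove_dep y (remove_dep x \<psi>)"
  by (induction \<psi>) auto

lemma ex_vars_subst [simp]: "ex_vars (subst \<psi> \<kappa> x) = ex_vars \<psi>"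
  by (induction \<psi>) auto

lemma all_vars_subst [simp]: "all_vars (subst \<psi> \<kappa> x) = all_vars \<psi>"
  by (induction \<psi>) auto

lemma dep_subst:
  "dep (subst \<psi> \<kappa> x) v =
    (if x \<in> dep \<psi> v then dep \<psi> v - {x} \<union> atom_vars \<kappa> else dep \<psi> v)"
  by (induction \<psi>) auto

text \<open>This convention lets free variables be treated like existential ones with nothing to
  depend on.\<close>

lemma dep_eq_empty: "v \<notin> ex_vars \<psi> \<Longrightarrow> dep \<psi> v = {}"
  by (induction \<psi>) auto

lemma dep_subset_dep_vars: "dep \<psi> v \<subseteq> dep_vars \<psi>"
  by (cases "v \<in> ex_vars \<psi>") (auto simp: dep_vars_def dep_eq_empty)

lemma finite_all_vars: "finite (all_vars \<psi>)"
  by (induction \<psi>) auto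

section \<open>Invariants of well-formed formulas\<close>

lemma remove_dep_dqbfs: "\<psi> \<in> dqbfs V \<Longrightarrow> remove_dep x \<psi> \<in> dqbfs V"
proof (induction rule: dqbfs.induct)
  case (ex \<phi> v D)
  \<comment> \<open>Rule \<open>ex\<close> yields bodies of the form \<open>remove_dep v _\<close>;
    commuting the two removals restores this form.\<close>
  have "Exists v (D - {x}) (remove_dep v (remove_dep x \<phi>)) \<in> dqbfs V"
    using ex by (intro dqbfs.ex) (auto simp: free_vars_def)
  then show ?case by (simp add: remove_dep_commute)
next
  case (conj \<phi>1 \<phi>2)
  then show ?case by (simp, intro dqbfs.conj) auto
next
  case (disj \<phi>1 \<phi>2)
  then show ?case by (simp, intro dqbfs.disj) auto
next
  case (all \<phi> v)
  then show ?case by (auto intro!: dqbfs.all simp: free_vars_def)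
qed (auto intro: dqbfs.intros)

lemma ex_vars_subset: "\<psi> \<in> dqbfs V \<Longrightarrow> ex_vars \<psi> \<subseteq> V - all_vars \<psi>"
  by (induction rule: dqbfs.induct) (auto simp: free_vars_def q_vars_def)

lemma vars_subset: "\<psi> \<in> dqbfs V \<Longrightarrow> vars \<psi> \<subseteq> V"
  by (induction rule: dqbfs.induct) (auto simp: free_vars_def)

text \<open>The body is \<open>remove_dep y\<close> of some DQBF, hence itself a DQBF by closure
  under \<open>remove_dep\<close>.\<close>

lemma Exists_dqbfsD:
  assumes "Exists y D \<phi> \<in> dqbfs V"
  shows "\<phi> \<in> dqbfs V" "y \<in> V" "y \<notin> q_vars \<phi>" "D \<inter> q_vars \<phi> = {}"
  using assms by (cases rule: dqbfs.cases; auto simp: free_vars_def remove_dep_dqbfs)+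

lemma Forall_dqbfsD:
  assumes "Forall x \<phi> \<in> dqbfs V"
  shows "\<phi> \<in> dqbfs V" "x \<in> V" "x \<notin> q_vars \<phi>"
  using assms by (cases rule: dqbfs.cases; auto simp: free_vars_def)+

lemma Conj_dqbfsD:
  assumes "Conj \<phi>\<^sub>1 \<phi>\<^sub>2 \<in> dqbfs V"
  shows "(vars \<phi>\<^sub>1 \<union> dep_vars \<phi>\<^sub>1) \<inter> q_vars \<phi>\<^sub>2 = {}" "(vars \<phi>\<^sub>2 \<union> dep_vars \<phi>\<^sub>2) \<inter> q_vars \<phi>\<^sub>1 = {}"
  using assms by (cases rule: dqbfs.cases; auto simp: vars_def)+

lemma Disj_dqbfsD:
  assumes "Disj \<phi>\<^sub>1 \<phi>\<^sub>2 \<in> dqbfs V"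
  shows "(vars \<phi>\<^sub>1 \<union> dep_vars \<phi>\<^sub>1) \<inter> q_vars \<phi>\<^sub>2 = {}" "(vars \<phi>\<^sub>2 \<union> dep_vars \<phi>\<^sub>2) \<inter> q_vars \<phi>\<^sub>1 = {}"
  using assms by (cases rule: dqbfs.cases; auto simp: vars_def)+

section \<open>Boolean functions and their supports\<close>

lemma boolfunsD: "f \<in> boolfuns W \<Longrightarrow> (\<And>v. v \<in> W \<Longrightarrow> a v = b v) \<Longrightarrow> f a = f b"
  unfolding boolfuns_def by blast

text \<open>Used to transport Skolem functions: \<open>g\<close> is the change of assignment, such
  as fixing a variable or copying one into another.\<close>

lemma boolfuns_comp:
  fixes g :: "('w \<Rightarrow> bool) \<Rightarrow> 'v \<Rightarrow> bool"
  assumes "f \<in> boolfuns W"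
    and "\<And>a b v. v \<in> W \<Longrightarrow> \<forall>w\<in>W'. a w = b w \<Longrightarrow> g a v = g b v"
  shows "(\<lambda>a. f (g a)) \<in> boolfuns W'"
  unfolding boolfuns_def
proof (intro CollectI allI impI)
  fix a b :: "'w \<Rightarrow> bool" assume "\<forall>w\<in>W'. a w = b w"
  then show "f (g a) = f (g b)" using assms(2) by (intro boolfunsD[OF assms(1)]) blast
qed

lemma boolfuns_mono: "W \<subseteq> W' \<Longrightarrow> f \<in> boolfuns W \<Longrightarrow> f \<in> boolfuns W'"
  unfolding boolfuns_def by blast

lemma const_in_boolfuns [simp]: "(\<lambda>_. b) \<in> boolfuns W"
  by (simp add: boolfuns_def)

lemma constant_fun_iff: "constant_fun f \<longleftrightarrow> f \<in> boolfuns {}"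
proof
  assume "f \<in> boolfuns {}"
  \<comment> \<open>Any assignment would do; the value at \<open>undefined\<close> serves as the
    constant.\<close>
  then have "f = (\<lambda>_. f undefined)" by (intro ext, rule boolfunsD) auto
  then show "constant_fun f" unfolding constant_fun_def by blast
qed (auto simp: constant_fun_def)

lemma supp_subset: "f \<in> boolfuns W \<Longrightarrow> supp f \<subseteq> W"
proof
  fix v assume f: "f \<in> boolfuns W" and "v \<in> supp f"
  then obtain a where a: "f (a(v := True)) \<noteq> f (a(v := False))" by (auto simp: supp_def)
  show "v \<in> W"
  proof (rule ccontr)
    assume "v \<notin> W"
    then have "f (a(v := True)) = f (a(v := False))" by (intro boolfunsD[OF f]) auto
    with a show False ..
  qed
qed

lemma supp_upd:
  assumes "v \<notin> supp f"
  shows "f (a(v := c)) = f a"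
proof -
  have "f (a(v := True)) = f (a(v := False))" using assms by (simp add: supp_def)
  then have "f (a(v := c)) = f (a(v := d))" for d by (cases c; cases d) simp_all
  \<comment> \<open>Choosing \<open>d\<close> as the present value of \<open>v\<close> turns the
    second update into the identity.\<close>
  from this[of "a v"] show ?thesis by simp
qed

text \<open>Variables outside the support are discarded one by one. Finiteness matters: over
  infinitely many variables, "infinitely many are true" has empty support without being
  constant.\<close>

lemma boolfuns_diff:
  assumes "finite X" "X \<inter> supp f = {}" "f \<in> boolfuns W"
  shows "f \<in> boolfuns (W - X)"
  using assms
proof (induction X)
  case (insert x X)
  then have f: "f \<in> boolfuns (W - X)" by auto
  show ?case unfolding boolfuns_def
  proof (intro CollectI allI impI)
    fix a b :: "'a \<Rightarrow> bool" assume ab: "\<forall>v\<in>W - insert x X. a v = b v"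
    \<comment> \<open>Correcting \<open>a\<close> at \<open>x\<close> costs nothing since
      \<open>x\<close> is outside the support; afterwards both assignments agree on
      \<open>W - X\<close>.\<close>
    have "f a = f (a(x := b x))" using insert.prems supp_upd[of x f] by auto
    also have "\<dots> = f b" using ab by (intro boolfunsD[OF f]) auto
    finally show "f a = f b" .
  qed
qed simp

text \<open>Merges the range condition and the support condition on a Skolem function into one. From
  left to right, the finite set \<open>W - U\<close> misses the support and can be
  discarded.\<close>

lemma boolfuns_supp:
  assumes "finite W"
  shows "f \<in> boolfuns W \<and> supp f \<subseteq> U \<inter> W \<longleftrightarrow> f \<in> boolfuns (U \<inter> W)"
proof
  assume *: "f \<in> boolfuns W \<and> supp f \<subseteq> U \<inter> W"
  then have "f \<in> boolfuns (W - (W - U))" using assms by (intro boolfuns_diff) auto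
  then show "f \<in> boolfuns (U \<inter> W)" by (rule boolfuns_mono[rotated]) auto
next
  assume "f \<in> boolfuns (U \<inter> W)"
  then show "f \<in> boolfuns W \<and> supp f \<subseteq> U \<inter> W"
    using supp_subset boolfuns_mono[of "U \<inter> W" W] by auto
qed

section \<open>Candidates as families of functions of the dependency sets\<close>

text \<open>For free \<open>v\<close> the set \<open>dep \<psi> v\<close> is empty, so constancy
  becomes an instance of the condition for existential variables. The assumption is weaker than
  membership in \<open>dqbfs V\<close>, so that expansions containing constants are covered as
  well.\<close>

lemma skolem_candidates_iff:
  assumes "ex_vars \<psi> \<subseteq> V - all_vars \<psi>"
  shows "s \<in> skolem_candidates V \<psi> \<longleftrightarrow> dom s = V - all_vars \<psi> \<and>
    (\<forall>v\<in>V - all_vars \<psi>. the (s v) \<in> boolfuns (dep \<psi> v \<inter> all_vars \<psi>))"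
proof -
  have "skolem_dom V \<psi> = V - all_vars \<psi>"
    using assms by (auto simp: skolem_dom_def free_vars_def q_vars_def)
  moreover have "ran s \<subseteq> boolfuns (all_vars \<psi>) \<and>
       (\<forall>v\<in>free_vars V \<psi>. constant_fun (the (s v))) \<and>
       (\<forall>v\<in>ex_vars \<psi>. supp (the (s v)) \<subseteq> dep \<psi> v \<inter> all_vars \<psi>)
     \<longleftrightarrow> (\<forall>v\<in>V - all_vars \<psi>. the (s v) \<in> boolfuns (dep \<psi> v \<inter> all_vars \<psi>))" (is "?L \<longleftrightarrow> ?R")
    if dom: "dom s = V - all_vars \<psi>"
  proof -
    let ?F = "free_vars V \<psi>" and ?E = "ex_vars \<psi>" and ?A = "all_vars \<psi>"
    have VA: "V - ?A = ?F \<union> ?E"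
      using assms by (auto simp: free_vars_def q_vars_def)
    have "ran s \<subseteq> boolfuns ?A \<longleftrightarrow> (\<forall>v\<in>?F \<union> ?E. the (s v) \<in> boolfuns ?A)"
      unfolding VA[symmetric] dom[symmetric] by (auto simp: ran_def dest: bspec[OF _ domI])
    then have "?L \<longleftrightarrow> (\<forall>v\<in>V - ?A. the (s v) \<in> boolfuns ?A \<and>
        (v \<in> ?F \<longrightarrow> constant_fun (the (s v))) \<and> (v \<in> ?E \<longrightarrow> supp (the (s v)) \<subseteq> dep \<psi> v \<inter> ?A))"
      unfolding VA by blast
    also have "\<dots> \<longleftrightarrow> ?R"
    proof (rule ball_cong[OF refl])
      fix v assume "v \<in> V - ?A"
      then consider "v \<in> ?F" "v \<notin> ?E" | "v \<in> ?E" "v \<notin> ?F"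
        using VA by (auto simp: free_vars_def q_vars_def)
      then show "the (s v) \<in> boolfuns ?A \<and> (v \<in> ?F \<longrightarrow> constant_fun (the (s v))) \<and>
          (v \<in> ?E \<longrightarrow> supp (the (s v)) \<subseteq> dep \<psi> v \<inter> ?A) \<longleftrightarrow>
          the (s v) \<in> boolfuns (dep \<psi> v \<inter> ?A)"
      proof cases
        case 1
        then show ?thesis
          using boolfuns_mono[of "{}" ?A] by (auto simp: dep_eq_empty constant_fun_iff)
      next
        case 2
        then show ?thesis using boolfuns_supp[OF finite_all_vars] by simp
      qed
    qed
    finally show ?thesis .
  qed
  ultimately show ?thesis unfolding skolem_candidates_def by blast
qed

text \<open>A total version of membership in \<open>sem\<close>. Values of \<open>S\<close> outside
  \<open>V - all_vars \<psi>\<close> are ignored, which avoids domain bookkeeping when a variable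
  changes its role.\<close>

definition solves :: "'v set \<Rightarrow> 'v dqbf \<Rightarrow> ('v \<Rightarrow> 'v boolfun) \<Rightarrow> bool" where
  "solves V \<psi> S \<longleftrightarrow>
    (\<forall>v\<in>V - all_vars \<psi>. S v \<in> boolfuns (dep \<psi> v \<inter> all_vars \<psi>)) \<and>
    (\<forall>a. matrix \<psi> (\<lambda>v. if v \<in> V - all_vars \<psi> then S v a else a v))"

lemma sem_nonempty_iff:
  assumes "ex_vars \<psi> \<subseteq> V - all_vars \<psi>"
  shows "sem V \<psi> \<noteq> {} \<longleftrightarrow> (\<exists>S. solves V \<psi> S)"
proof
  assume "sem V \<psi> \<noteq> {}"
  then obtain s where s: "s \<in> skolem_candidates V \<psi>" "tautology (inst s \<psi>)"
    by (auto simp: sem_def)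
  have dom: "dom s = V - all_vars \<psi>" using s skolem_candidates_iff[OF assms] by auto
  have "extend s a = (\<lambda>v. if v \<in> V - all_vars \<psi> then the (s v) a else a v)" for a
    unfolding dom[symmetric] by (auto simp: extend_def fun_eq_iff split: option.splits)
  then have "solves V \<psi> (\<lambda>v. the (s v))"
    using s skolem_candidates_iff[OF assms]
    by (simp add: solves_def tautology_def inst_eq_matrix[of s])
  then show "\<exists>S. solves V \<psi> S" by blast
next
  assume "\<exists>S. solves V \<psi> S"
  then obtain S where S: "solves V \<psi> S" by blast
  define s where "s = (\<lambda>v. if v \<in> V - all_vars \<psi> then Some (S v) else None)"
  have ext: "extend s a = (\<lambda>v. if v \<in> V - all_vars \<psi> then S v a else a v)" for a
    by (auto simp: extend_def fun_eq_iff s_def)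
  have dom: "dom s = V - all_vars \<psi>" by (auto simp: s_def split: if_splits)
  have "the (s v) = S v" if "v \<in> V - all_vars \<psi>" for v using that by (simp add: s_def)
  then have "s \<in> skolem_candidates V \<psi>"
    using S dom unfolding solves_def skolem_candidates_iff[OF assms] by simp
  moreover have "tautology (inst s \<psi>)"
    unfolding tautology_def inst_eq_matrix[of s] ext using S by (simp add: solves_def)
  ultimately have "s \<in> sem V \<psi>" by (simp add: sem_def)
  then show "sem V \<psi> \<noteq> {}" by blast
qed

lemma equisatisfiableI:
  assumes "ex_vars \<psi>\<^sub>1 \<subseteq> V - all_vars \<psi>\<^sub>1" "ex_vars \<psi>\<^sub>2 \<subseteq> V - all_vars \<psi>\<^sub>2"
    and "\<And>S. solves V \<psi>\<^sub>1 S \<Longrightarrow> \<exists>T. solves V \<psi>\<^sub>2 T"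
    and "\<And>T. solves V \<psi>\<^sub>2 T \<Longrightarrow> \<exists>S. solves V \<psi>\<^sub>1 S"
  shows "equisatisfiable V \<psi>\<^sub>1 \<psi>\<^sub>2"
  using assms sem_nonempty_iff[of \<psi>\<^sub>1 V] sem_nonempty_iff[of \<psi>\<^sub>2 V]
  unfolding equisatisfiable_def by blast

text \<open>Serves the rules that only rearrange the prefix: no Skolem function has to be
  changed.\<close>

lemma equivalentI:
  assumes "ex_vars \<psi>\<^sub>1 = ex_vars \<psi>\<^sub>2" "all_vars \<psi>\<^sub>1 = all_vars \<psi>\<^sub>2" "dep \<psi>\<^sub>1 = dep \<psi>\<^sub>2"
    and "\<And>s. inst s \<psi>\<^sub>1 = inst s \<psi>\<^sub>2"
  shows "equivalent V \<psi>\<^sub>1 \<psi>\<^sub>2"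
  using assms
  by (simp add: equivalent_def sem_def skolem_candidates_def skolem_dom_def free_vars_def q_vars_def)

section \<open>Eliminating a single quantifier\<close>

lemma Exists_equivalent:
  assumes "Exists y D \<phi> \<in> dqbfs V"
  shows "equivalent V (Exists y D \<phi>) \<phi>"
proof -
  note E = Exists_dqbfsD[OF assms]
  have "y \<notin> ex_vars \<phi>" "D \<inter> all_vars \<phi> = {}" using E by (auto simp: q_vars_def)
  \<comment> \<open>At \<open>v = y\<close> both sides are empty: \<open>D\<close> contains no
    universal variable of the body, and \<open>y\<close> is free in the body.\<close>
  then have "dep (Exists y D \<phi>) v \<inter> all_vars \<phi> = dep \<phi> v \<inter> all_vars \<phi>" for v
    by (auto simp: dep_eq_empty)
  then have "s \<in> skolem_candidates V (Exists y D \<phi>) \<longleftrightarrow> s \<in> skolem_candidates V \<phi>" for s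
    unfolding skolem_candidates_iff[OF ex_vars_subset[OF assms]]
      skolem_candidates_iff[OF ex_vars_subset[OF E(1)]] by simp
  then show ?thesis by (auto simp: equivalent_def sem_def)
qed

text \<open>The matrix never reads \<open>x\<close>, so Skolem functions may be evaluated with
  \<open>x\<close> frozen. Conversely, functions with fewer dependencies remain admissible.\<close>

lemma Forall_equisatisfiable_remove_dep:
  assumes "Forall x \<phi> \<in> dqbfs V" "x \<notin> vars \<phi>"
  shows "equisatisfiable V (Forall x \<phi>) (remove_dep x \<phi>)"
proof (rule equisatisfiableI)
  show "ex_vars (Forall x \<phi>) \<subseteq> V - all_vars (Forall x \<phi>)"
    using assms(1) by (rule ex_vars_subset)
  show "ex_vars (remove_dep x \<phi>) \<subseteq> V - all_vars (remove_dep x \<phi>)"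
    by (rule ex_vars_subset[OF remove_dep_dqbfs[OF Forall_dqbfsD(1)[OF assms(1)]]])
  show "\<exists>T. solves V (remove_dep x \<phi>) T" if S: "solves V (Forall x \<phi>) S" for S
  proof -
    define T where "T v = (if v = x then (\<lambda>_. False) else (\<lambda>a. S v (a(x := False))))" for v
    have "T v \<in> boolfuns ((dep \<phi> v - {x}) \<inter> all_vars \<phi>)" if "v \<in> V - all_vars \<phi>" for v
    proof (cases "v = x")
      case False
      then have "S v \<in> boolfuns (dep \<phi> v \<inter> insert x (all_vars \<phi>))"
        using S that by (simp add: solves_def)
      then have "(\<lambda>a. S v (a(x := False))) \<in> boolfuns ((dep \<phi> v - {x}) \<inter> all_vars \<phi>)"
        by (rule boolfuns_comp) auto
      then show ?thesis using False by (simp add: T_def)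
    qed (simp add: T_def)
    moreover have "matrix \<phi> (\<lambda>v. if v \<in> V - all_vars \<phi> then T v a else a v)" for a
    proof -
      have "matrix \<phi> (\<lambda>v. if v \<in> V - all_vars (Forall x \<phi>) then S v (a(x := False))
          else (a(x := False)) v)"
        using S unfolding solves_def by simp
      also have "matrix \<phi> (\<lambda>v. if v \<in> V - all_vars (Forall x \<phi>) then S v (a(x := False))
          else (a(x := False)) v) = matrix \<phi> (\<lambda>v. if v \<in> V - all_vars \<phi> then T v a else a v)"
        using assms(2) by (intro matrix_cong) (auto simp: T_def)
      finally show ?thesis .
    qed
    ultimately have "solves V (remove_dep x \<phi>) T" by (simp add: solves_def)
    then show ?thesis by blast
  qed
  show "\<exists>S. solves V (Forall x \<phi>) S" if T: "solves V (remove_dep x \<phi>) T" for T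
  proof -
    have "T v \<in> boolfuns (dep \<phi> v \<inter> insert x (all_vars \<phi>))" if "v \<in> V - insert x (all_vars \<phi>)" for v
    proof (rule boolfuns_mono)
      show "T v \<in> boolfuns ((dep \<phi> v - {x}) \<inter> all_vars \<phi>)"
        using T that by (simp add: solves_def)
    qed auto
    moreover have "matrix \<phi> (\<lambda>v. if v \<in> V - insert x (all_vars \<phi>) then T v a else a v)" for a
    proof -
      have "matrix \<phi> (\<lambda>v. if v \<in> V - all_vars \<phi> then T v a else a v)"
        using T unfolding solves_def by simp
      also have "matrix \<phi> (\<lambda>v. if v \<in> V - all_vars \<phi> then T v a else a v)
          = matrix \<phi> (\<lambda>v. if v \<in> V - insert x (all_vars \<phi>) then T v a else a v)"
        using assms(2) by (intro matrix_cong) auto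
      finally show ?thesis .
    qed
    ultimately have "solves V (Forall x \<phi>) T" by (simp add: solves_def)
    then show ?thesis by blast
  qed
qed

text \<open>Without quantifiers in \<open>\<phi>\<close> all Skolem functions are constants, and
  validity for all values of \<open>x\<close> is validity of both instances. The extra value at
  \<open>x\<close> in candidates of the expansion is overwritten by the substitution.\<close>

lemma Forall_equivalent_common_expansion:
  assumes "x \<in> V" "all_vars \<phi> = {}" "ex_vars \<phi> = {}"
  shows "equivalent_common V (Forall x \<phi>)
    (Conj (subst \<phi> (Const False) x) (subst \<phi> (Const True) x))"
proof -
  let ?\<psi> = "Forall x \<phi>" and ?\<chi> = "Conj (subst \<phi> (Const False) x) (subst \<phi> (Const True) x)"
  have dep: "dep \<phi> v = {}" for v using assms by (simp add: dep_eq_empty)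
  have A: "skolem_dom V ?\<psi> \<inter> skolem_dom V ?\<chi> = V - {x}"
    using assms by (auto simp: skolem_dom_def free_vars_def q_vars_def)
  have s: "s \<in> skolem_candidates V ?\<psi> \<longleftrightarrow> dom s = V - {x} \<and> (\<forall>v\<in>V - {x}. the (s v) \<in> boolfuns {})"
    for s using assms by (subst skolem_candidates_iff) (auto simp: dep)
  have t: "t \<in> skolem_candidates V ?\<chi> \<longleftrightarrow> dom t = V \<and> (\<forall>v\<in>V. the (t v) \<in> boolfuns {})"
    for t using assms by (subst skolem_candidates_iff) (auto simp: dep dep_subst)
  \<comment> \<open>Candidates agreeing off \<open>x\<close> are both solutions or both not; it then
    remains to find a partner for each candidate.\<close>
  have iff: "s \<in> sem V ?\<psi> \<longleftrightarrow> t \<in> sem V ?\<chi>"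
    if S: "s \<in> skolem_candidates V ?\<psi>" and T: "t \<in> skolem_candidates V ?\<chi>"
      and eq: "s |` (V - {x}) = t |` (V - {x})" for s t
  proof -
    \<comment> \<open>Updating at \<open>x\<close> erases the value given by \<open>t\<close>;
      elsewhere on \<open>V\<close> the functions are constant, so they ignore the change of
      argument.\<close>
    have ext: "(extend t a)(x := b) = extend s (a(x := b))" for a b
    proof
      fix v
      have "s v = t v" if "v \<in> V - {x}"
        using fun_cong[OF eq, of v] that by simp
      moreover have "f a = f (a(x := b))" if "t v = Some f" "v \<in> V" for f
        using T that unfolding t by (intro boolfunsD[of f "{}"]) (auto dest: bspec[OF _ domI])
      moreover have "s v = None" if "v \<notin> V - {x}" using S that unfolding s by (auto simp: domIff)
      moreover have "t v = None" if "v \<notin> V" using T that unfolding t by (auto simp: domIff)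
      ultimately show "((extend t a)(x := b)) v = extend s (a(x := b)) v"
        by (cases "v \<in> V"; cases "v = x") (auto simp: extend_def split: option.splits)
    qed
    have "tautology (inst t ?\<chi>) \<longleftrightarrow> (\<forall>a b. matrix \<phi> (extend s (a(x := b))))"
      by (simp add: tautology_def inst_eq_matrix[of t] matrix_subst ext) (metis (full_types))
    also have "\<dots> \<longleftrightarrow> tautology (inst s ?\<psi>)"
      by (simp add: tautology_def inst_eq_matrix[of s]) (metis fun_upd_triv)
    finally show ?thesis using S T by (simp add: sem_def)
  qed
  \<comment> \<open>A partner arises by adding an arbitrary constant at \<open>x\<close>, and in the
    other direction by forgetting the value there.\<close>
  have ex1: "\<exists>t\<in>skolem_candidates V ?\<chi>. s |` (V - {x}) = t |` (V - {x})"
    if "s \<in> skolem_candidates V ?\<psi>" for s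
    using that assms(1) unfolding s t
    by (intro bexI[of _ "s(x \<mapsto> (\<lambda>_. False))"]) (auto simp: t restrict_map_def)
  have ex2: "\<exists>s\<in>skolem_candidates V ?\<psi>. s |` (V - {x}) = t |` (V - {x})"
    if "t \<in> skolem_candidates V ?\<chi>" for t
    using that unfolding s t by (intro bexI[of _ "t |` (V - {x})"]) (auto simp: s)
  have sub: "sem V \<psi> \<subseteq> skolem_candidates V \<psi>" for \<psi> by (auto simp: sem_def)
  show ?thesis
    unfolding equivalent_common_def Let_def A
  proof (intro conjI set_eqI iffI)
    fix s assume "s \<in> sem V ?\<psi>"
    then show "s \<in> {s \<in> skolem_candidates V ?\<psi>. \<exists>t\<in>sem V ?\<chi>. s |` (V - {x}) = t |` (V - {x})}"
      using ex1 iff sub by blast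
  next
    fix s assume "s \<in> {s \<in> skolem_candidates V ?\<psi>. \<exists>t\<in>sem V ?\<chi>. s |` (V - {x}) = t |` (V - {x})}"
    then show "s \<in> sem V ?\<psi>" using iff sub by blast
  next
    fix t assume "t \<in> sem V ?\<chi>"
    then show "t \<in> {t \<in> skolem_candidates V ?\<chi>. \<exists>s\<in>sem V ?\<psi>. s |` (V - {x}) = t |` (V - {x})}"
      using ex2 iff sub by blast
  next
    fix t assume "t \<in> {t \<in> skolem_candidates V ?\<chi>. \<exists>s\<in>sem V ?\<psi>. s |` (V - {x}) = t |` (V - {x})}"
    then show "t \<in> sem V ?\<chi>" using iff sub by blast
  qed
qed

text \<open>From left to right the value of \<open>y\<close> selects the true disjunct. From right
  to left one value of \<open>y\<close> must suit all assignments; since every function is constant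
  and \<open>\<phi>\<close> reads only \<open>V\<close>, a single assignment \<open>a0\<close>
  decides it.\<close>

lemma Exists_equisatisfiable_expansion:
  assumes "y \<in> V" "all_vars \<phi> = {}" "ex_vars \<phi> = {}"
    and vars: "fs_vars \<phi> \<subseteq> V"
  shows "equisatisfiable V (Exists y D \<phi>)
    (Disj (subst \<phi> (Const False) y) (subst \<phi> (Const True) y))" (is "equisatisfiable V ?\<psi> ?\<chi>")
proof (rule equisatisfiableI)
  have dep: "dep \<phi> v = {}" for v using assms by (simp add: dep_eq_empty)
  show "ex_vars ?\<psi> \<subseteq> V - all_vars ?\<psi>" "ex_vars ?\<chi> \<subseteq> V - all_vars ?\<chi>"
    using assms by auto
  show "\<exists>T. solves V ?\<chi> T" if S: "solves V ?\<psi> S" for S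
  proof -
    have "matrix \<phi> ((\<lambda>v. if v \<in> V then S v a else a v)(y := False)) \<or>
      matrix \<phi> ((\<lambda>v. if v \<in> V then S v a else a v)(y := True))" for a
    proof -
      define e where "e = (\<lambda>v. if v \<in> V then S v a else a v)"
      have "matrix \<phi> e" using S assms by (simp add: solves_def e_def)
      moreover have "e = e(y := e y)" by simp
      ultimately have "matrix \<phi> (e(y := False)) \<or> matrix \<phi> (e(y := True))"
        by (cases "e y") metis+
      then show ?thesis unfolding e_def .
    qed
    then have "solves V ?\<chi> S"
      using S assms by (auto simp: solves_def dep dep_subst matrix_subst)
    then show ?thesis by blast
  qed
  show "\<exists>S. solves V ?\<psi> S" if T: "solves V ?\<chi> T" for T
  proof -
    define a0 :: "'a \<Rightarrow> bool" where "a0 = (\<lambda>_. False)"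
    have "matrix \<phi> ((\<lambda>v. if v \<in> V then T v a0 else a0 v)(y := False)) \<or>
        matrix \<phi> ((\<lambda>v. if v \<in> V then T v a0 else a0 v)(y := True))"
      using T assms by (simp add: solves_def matrix_subst)
    then obtain b where b: "matrix \<phi> ((\<lambda>v. if v \<in> V then T v a0 else a0 v)(y := b))"
      by (elim disjE) (rule that)+
    have const: "T v a = T v a0" if "v \<in> V" for v a
      using T that assms by (intro boolfunsD[of "T v" "{}"]) (auto simp: solves_def dep dep_subst)
    have "matrix \<phi> (\<lambda>v. if v \<in> V then (T(y := \<lambda>_. b)) v a else a v)" for a
    proof -
      have "matrix \<phi> (\<lambda>v. if v \<in> V then (T(y := \<lambda>_. b)) v a else a v)
          = matrix \<phi> ((\<lambda>v. if v \<in> V then T v a0 else a0 v)(y := b))"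
        using vars assms const[of _ a] by (intro matrix_cong) (auto simp: vars_def q_vars_def)
      then show ?thesis using b by simp
    qed
    then have "solves V ?\<psi> (T(y := \<lambda>_. b))"
      using T assms by (auto simp: solves_def dep dep_subst)
    then show ?thesis by blast
  qed
qed

section \<open>Distributing a quantifier over a connective\<close>

text \<open>Each conjunct reads only its own existential variables and shared constants. So the
  functions for \<open>\<phi>\<^sub>2\<close> can be renamed alone, and the conjuncts may be checked
  at different assignments.\<close>

lemma Forall_Conj_rename_equisatisfiable:
  assumes L: "Forall x (Conj \<phi>\<^sub>1 \<phi>\<^sub>2) \<in> dqbfs V"
    and R: "Conj (Forall x \<phi>\<^sub>1) (Forall x' (subst \<phi>\<^sub>2 (Var x') x)) \<in> dqbfs V"
    and occ: "\<not> occurs x' \<phi>\<^sub>1" "\<not> occurs x' \<phi>\<^sub>2"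
  shows "equisatisfiable V (Forall x (Conj \<phi>\<^sub>1 \<phi>\<^sub>2))
    (Conj (Forall x \<phi>\<^sub>1) (Forall x' (subst \<phi>\<^sub>2 (Var x') x)))" (is "equisatisfiable V ?\<psi> ?\<chi>")
proof (rule equisatisfiableI)
  note C = Conj_dqbfsD[OF Forall_dqbfsD(1)[OF L]]
  have neq: "x \<noteq> x'" using Conj_dqbfsD[OF R] by (auto simp: q_vars_def vars_def)
  have x': "x' \<notin> vars \<phi>\<^sub>1" "x' \<notin> vars \<phi>\<^sub>2" "x' \<notin> dep \<phi>\<^sub>1 v" "x' \<notin> dep \<phi>\<^sub>2 v" for v
    using occ dep_subset_dep_vars[of \<phi>\<^sub>1 v] dep_subset_dep_vars[of \<phi>\<^sub>2 v]
    by (auto simp: occurs_def)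
  let ?A = "all_vars \<phi>\<^sub>1 \<union> all_vars \<phi>\<^sub>2"
  have A\<psi>: "all_vars ?\<psi> = insert x ?A" and A\<chi>: "all_vars ?\<chi> = insert x (insert x' ?A)"
    by auto
  have ex12: "v \<notin> ex_vars \<phi>\<^sub>2" if "v \<in> vars \<phi>\<^sub>1" for v using C that by (auto simp: q_vars_def)
  have ex21: "v \<notin> ex_vars \<phi>\<^sub>1" if "v \<in> vars \<phi>\<^sub>2" for v using C that by (auto simp: q_vars_def)
  have ex1: "v \<in> vars \<phi>\<^sub>1" if "v \<in> ex_vars \<phi>\<^sub>1" for v using that by (auto simp: vars_def q_vars_def)
  have ex2: "v \<in> vars \<phi>\<^sub>2" if "v \<in> ex_vars \<phi>\<^sub>2" for v using that by (auto simp: vars_def q_vars_def)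
  have dep1: "dep \<phi>\<^sub>1 v = {}" if "v \<in> vars \<phi>\<^sub>2" for v using ex21[OF that] by (rule dep_eq_empty)
  show "ex_vars ?\<psi> \<subseteq> V - all_vars ?\<psi>" using L by (rule ex_vars_subset)
  show "ex_vars ?\<chi> \<subseteq> V - all_vars ?\<chi>" using R by (rule ex_vars_subset)
  show "\<exists>T. solves V ?\<chi> T" if S: "solves V ?\<psi> S" for S
  proof -
    have Sb: "S v \<in> boolfuns ((dep \<phi>\<^sub>1 v \<union> dep \<phi>\<^sub>2 v) \<inter> insert x ?A)"
      if "v \<in> V - insert x ?A" for v
      using S that unfolding solves_def A\<psi> by simp
    have Sm: "matrix \<phi>\<^sub>1 (\<lambda>v. if v \<in> V - insert x ?A then S v a else a v)"
      "matrix \<phi>\<^sub>2 (\<lambda>v. if v \<in> V - insert x ?A then S v a else a v)" for a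
      using S unfolding solves_def A\<psi> by simp_all
    \<comment> \<open>Only functions belonging to \<open>\<phi>\<^sub>2\<close> read
      \<open>x'\<close> in place of \<open>x\<close>.\<close>
    define T where "T v = (if v \<in> ex_vars \<phi>\<^sub>2 then (\<lambda>a. S v (a(x := a x'))) else S v)" for v
    have "T v \<in> boolfuns (dep ?\<chi> v \<inter> all_vars ?\<chi>)" if v: "v \<in> V - all_vars ?\<chi>" for v
    proof (cases "v \<in> ex_vars \<phi>\<^sub>2")
      case True
      have "S v \<in> boolfuns (dep \<phi>\<^sub>2 v \<inter> insert x ?A)"
        using Sb[of v] v dep1[OF ex2[OF True]] by auto
      then have "(\<lambda>a. S v (a(x := a x'))) \<in> boolfuns (dep ?\<chi> v \<inter> all_vars ?\<chi>)"
        by (rule boolfuns_comp) (auto simp: dep_subst split: if_splits)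
      then show ?thesis using True by (simp add: T_def)
    next
      case False
      then show ?thesis using Sb[of v] v unfolding T_def A\<chi>
        by (auto simp: dep_subst dep_eq_empty[of v \<phi>\<^sub>2] elim!: boolfuns_mono[rotated])
    qed
    moreover have "matrix ?\<chi> (\<lambda>v. if v \<in> V - all_vars ?\<chi> then T v a else a v)" for a
    proof -
      let ?e = "\<lambda>v. if v \<in> V - all_vars ?\<chi> then T v a else a v"
      let ?a = "a(x := a x')"
      have "matrix \<phi>\<^sub>1 ?e = matrix \<phi>\<^sub>1 (\<lambda>v. if v \<in> V - insert x ?A then S v a else a v)"
        using ex12 x' by (intro matrix_cong) (auto simp: T_def A\<chi>)
      moreover have "matrix \<phi>\<^sub>2 (?e(x := ?e x'))
          = matrix \<phi>\<^sub>2 (\<lambda>v. if v \<in> V - insert x ?A then S v ?a else ?a v)"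
      proof (rule matrix_cong)
        fix v assume v: "v \<in> vars \<phi>\<^sub>2"
        \<comment> \<open>A variable of \<open>\<phi>\<^sub>2\<close> not quantified existentially
          there has no dependencies on either side, so its function is constant.\<close>
        have "S v a = S v ?a" if "v \<in> V - insert x ?A" "v \<notin> ex_vars \<phi>\<^sub>2"
          using Sb[OF that(1)] dep1[OF v] that
          by (intro boolfunsD[of "S v" "{}"]) (auto simp: dep_eq_empty)
        then show "(?e(x := ?e x')) v = (if v \<in> V - insert x ?A then S v ?a else ?a v)"
          using v x' by (auto simp: T_def A\<chi>)
      qed
      ultimately show ?thesis using Sm by (simp add: matrix_subst)
    qed
    ultimately have "solves V ?\<chi> T" unfolding solves_def by blast
    then show ?thesis by blast
  qed
  show "\<exists>S. solves V ?\<psi> S" if T: "solves V ?\<chi> T" for T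
  proof -
    have Tb: "T v \<in> boolfuns ((dep \<phi>\<^sub>1 v \<union> dep (subst \<phi>\<^sub>2 (Var x') x) v) \<inter> insert x (insert x' ?A))"
      if "v \<in> V - insert x (insert x' ?A)" for v
      using T that unfolding solves_def A\<chi> by simp
    have Tm: "matrix \<phi>\<^sub>1 (\<lambda>v. if v \<in> V - insert x (insert x' ?A) then T v a else a v)"
      "matrix \<phi>\<^sub>2 ((\<lambda>v. if v \<in> V - insert x (insert x' ?A) then T v a else a v)(x := a x'))" for a
      using T unfolding solves_def A\<chi> by (simp_all add: matrix_subst)
    \<comment> \<open>The inverse renaming. On the left \<open>x'\<close> is free and receives an
      arbitrary constant.\<close>
    define S where "S v = (if v \<in> ex_vars \<phi>\<^sub>2 then (\<lambda>a. T v (a(x' := a x)))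
      else if v = x' then (\<lambda>_. False) else T v)" for v
    have "S v \<in> boolfuns (dep ?\<psi> v \<inter> all_vars ?\<psi>)" if v: "v \<in> V - all_vars ?\<psi>" for v
    proof (cases "v \<in> ex_vars \<phi>\<^sub>2")
      case True
      then have "v \<noteq> x'" using x' ex2 by blast
      then have "T v \<in> boolfuns (dep (subst \<phi>\<^sub>2 (Var x') x) v \<inter> insert x (insert x' ?A))"
        using Tb[of v] v dep1[OF ex2[OF True]] by auto
      then have "(\<lambda>a. T v (a(x' := a x))) \<in> boolfuns (dep ?\<psi> v \<inter> all_vars ?\<psi>)"
        by (rule boolfuns_comp) (use neq x' in \<open>auto simp: dep_subst split: if_splits\<close>)
      then show ?thesis using True by (simp add: S_def)
    next
      case False
      then show ?thesis using Tb[of v] v x' unfolding S_def A\<psi>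
        by (auto simp: dep_subst dep_eq_empty[of v \<phi>\<^sub>2] elim!: boolfuns_mono[rotated])
    qed
    moreover have "matrix ?\<psi> (\<lambda>v. if v \<in> V - all_vars ?\<psi> then S v a else a v)" for a
    proof -
      let ?e = "\<lambda>v. if v \<in> V - all_vars ?\<psi> then S v a else a v"
      let ?a = "a(x' := a x)"
      have "matrix \<phi>\<^sub>1 ?e = matrix \<phi>\<^sub>1 (\<lambda>v. if v \<in> V - insert x (insert x' ?A) then T v a else a v)"
        using ex12 x' by (intro matrix_cong) (auto simp: S_def A\<psi>)
      moreover have "matrix \<phi>\<^sub>2 ?e = matrix \<phi>\<^sub>2
          ((\<lambda>v. if v \<in> V - insert x (insert x' ?A) then T v ?a else ?a v)(x := ?a x'))"
      proof (rule matrix_cong)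
        fix v assume v: "v \<in> vars \<phi>\<^sub>2"
        have "T v a = T v ?a" if "v \<in> V - insert x (insert x' ?A)" "v \<notin> ex_vars \<phi>\<^sub>2"
          using Tb[OF that(1)] dep1[OF v] that
          by (intro boolfunsD[of "T v" "{}"]) (auto simp: dep_eq_empty dep_subst)
        moreover have "v \<noteq> x'" using v x' by blast
        ultimately show "?e v =
            ((\<lambda>v. if v \<in> V - insert x (insert x' ?A) then T v ?a else ?a v)(x := ?a x')) v"
          by (auto simp: S_def A\<psi>)
      qed
      \<comment> \<open>The first conjunct is taken at \<open>a\<close>, the second at
        \<open>?a\<close>, where \<open>x'\<close> carries the value of \<open>x\<close>.\<close>
      ultimately show ?thesis using Tm(1)[of a] Tm(2)[of ?a] by (simp only: inst.simps)
    qed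
    ultimately have "solves V ?\<psi> S" unfolding solves_def by blast
    then show ?thesis by blast
  qed
qed

text \<open>Freezing \<open>x\<close> in the functions for \<open>\<phi>\<^sub>1\<close> is
  harmless: \<open>\<phi>\<^sub>1\<close> does not read \<open>x\<close>, and
  \<open>\<phi>\<^sub>2\<close> does not read those functions. Conversely, a solution of the right
  side also solves the left, whose dependency sets are larger.\<close>

lemma Forall_Conj_left_equisatisfiable:
  assumes L: "Forall x (Conj \<phi>\<^sub>1 \<phi>\<^sub>2) \<in> dqbfs V"
    and R: "Conj (remove_dep x \<phi>\<^sub>1) (Forall x \<phi>\<^sub>2) \<in> dqbfs V"
    and x: "x \<notin> vars \<phi>\<^sub>1"
  shows "equisatisfiable V (Forall x (Conj \<phi>\<^sub>1 \<phi>\<^sub>2)) (Conj (remove_dep x \<phi>\<^sub>1) (Forall x \<phi>\<^sub>2))"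
    (is "equisatisfiable V ?\<psi> ?\<chi>")
proof (rule equisatisfiableI)
  note C = Conj_dqbfsD[OF Forall_dqbfsD(1)[OF L]]
  let ?A = "insert x (all_vars \<phi>\<^sub>1 \<union> all_vars \<phi>\<^sub>2)"
  have A: "all_vars ?\<psi> = ?A" "all_vars ?\<chi> = ?A" by auto
  have ex1: "v \<in> vars \<phi>\<^sub>1" if "v \<in> ex_vars \<phi>\<^sub>1" for v using that by (auto simp: vars_def q_vars_def)
  have ex12: "v \<notin> ex_vars \<phi>\<^sub>2" if "v \<in> vars \<phi>\<^sub>1" for v using C that by (auto simp: q_vars_def)
  have ex21: "v \<notin> ex_vars \<phi>\<^sub>1" if "v \<in> vars \<phi>\<^sub>2" for v using C that by (auto simp: q_vars_def)
  show "ex_vars ?\<psi> \<subseteq> V - all_vars ?\<psi>" using L by (rule ex_vars_subset)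
  show "ex_vars ?\<chi> \<subseteq> V - all_vars ?\<chi>" using R by (rule ex_vars_subset)
  show "\<exists>T. solves V ?\<chi> T" if S: "solves V ?\<psi> S" for S
  proof -
    have Sb: "S v \<in> boolfuns ((dep \<phi>\<^sub>1 v \<union> dep \<phi>\<^sub>2 v) \<inter> ?A)" if "v \<in> V - ?A" for v
      using S that unfolding solves_def A by simp
    have Sm: "matrix \<phi>\<^sub>1 (\<lambda>v. if v \<in> V - ?A then S v a else a v)"
      "matrix \<phi>\<^sub>2 (\<lambda>v. if v \<in> V - ?A then S v a else a v)" for a
      using S unfolding solves_def A by simp_all
    define T where "T v = (if v \<in> ex_vars \<phi>\<^sub>1 then (\<lambda>a. S v (a(x := False))) else S v)" for v
    have "T v \<in> boolfuns (dep ?\<chi> v \<inter> all_vars ?\<chi>)" if v: "v \<in> V - all_vars ?\<chi>" for v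
    proof (cases "v \<in> ex_vars \<phi>\<^sub>1")
      case True
      have "S v \<in> boolfuns (dep \<phi>\<^sub>1 v \<inter> ?A)"
        using Sb[of v] v dep_eq_empty[OF ex12[OF ex1[OF True]]] by auto
      then have "(\<lambda>a. S v (a(x := False))) \<in> boolfuns (dep ?\<chi> v \<inter> all_vars ?\<chi>)"
        by (rule boolfuns_comp) auto
      then show ?thesis using True by (simp add: T_def)
    next
      case False
      then show ?thesis using Sb[of v] v unfolding T_def A
        by (auto simp: dep_eq_empty[of v \<phi>\<^sub>1])
    qed
    moreover have "matrix ?\<chi> (\<lambda>v. if v \<in> V - all_vars ?\<chi> then T v a else a v)" for a
    proof -
      let ?e = "\<lambda>v. if v \<in> V - ?A then T v a else a v"
      let ?a = "a(x := False)"
      \<comment> \<open>The first conjunct holds at \<open>a\<close> because the given solution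
        makes it hold at \<open>a(x := False)\<close>.\<close>
      have "matrix \<phi>\<^sub>1 ?e = matrix \<phi>\<^sub>1 (\<lambda>v. if v \<in> V - ?A then S v ?a else ?a v)"
      proof (rule matrix_cong)
        fix v assume v: "v \<in> vars \<phi>\<^sub>1"
        have "S v a = S v ?a" if "v \<in> V - ?A" "v \<notin> ex_vars \<phi>\<^sub>1"
          using Sb[OF that(1)] that ex12[OF v]
          by (intro boolfunsD[of "S v" "{}"]) (auto simp: dep_eq_empty)
        then show "?e v = (if v \<in> V - ?A then S v ?a else ?a v)"
          using v x by (auto simp: T_def)
      qed
      moreover have "matrix \<phi>\<^sub>2 ?e = matrix \<phi>\<^sub>2 (\<lambda>v. if v \<in> V - ?A then S v a else a v)"
        using ex21 by (intro matrix_cong) (auto simp: T_def)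
      ultimately show ?thesis using Sm unfolding A by simp
    qed
    ultimately have "solves V ?\<chi> T" unfolding solves_def by blast
    then show ?thesis by blast
  qed
  show "\<exists>S. solves V ?\<psi> S" if T: "solves V ?\<chi> T" for T
  proof -
    have "T v \<in> boolfuns (dep ?\<psi> v \<inter> ?A)" if "v \<in> V - ?A" for v
    proof (rule boolfuns_mono)
      show "T v \<in> boolfuns (dep ?\<chi> v \<inter> ?A)" using T that unfolding solves_def A by blast
    qed auto
    then have "solves V ?\<psi> T" using T unfolding solves_def A by simp
    then show ?thesis by blast
  qed
qed

text \<open>From left to right \<open>y'\<close> copies the function of \<open>y\<close>. From right
  to left one disjunct alone is a tautology, and its own choice for the quantified variable is used
  for \<open>y\<close>.\<close>

lemma Exists_Disj_rename_equisatisfiable: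
  assumes L: "Exists y D (Disj \<phi>\<^sub>1 \<phi>\<^sub>2) \<in> dqbfs V"
    and R: "Disj (Exists y D \<phi>\<^sub>1) (Exists y' D (subst \<phi>\<^sub>2 (Var y') y)) \<in> dqbfs V"
    and occ: "\<not> occurs y' \<phi>\<^sub>1" "\<not> occurs y' \<phi>\<^sub>2"
  shows "equisatisfiable V (Exists y D (Disj \<phi>\<^sub>1 \<phi>\<^sub>2))
    (Disj (Exists y D \<phi>\<^sub>1) (Exists y' D (subst \<phi>\<^sub>2 (Var y') y)))" (is "equisatisfiable V ?\<psi> ?\<chi>")
proof (rule equisatisfiableI)
  note E = Exists_dqbfsD[OF L]
  note C = Disj_dqbfsD[OF E(1)]
  have V: "vars \<phi>\<^sub>1 \<subseteq> V" "vars \<phi>\<^sub>2 \<subseteq> V" using vars_subset[OF E(1)] by auto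
  let ?A = "all_vars \<phi>\<^sub>1 \<union> all_vars \<phi>\<^sub>2"
  have neq: "y \<noteq> y'" using Disj_dqbfsD[OF R] by (auto simp: q_vars_def vars_def)
  have y: "y \<notin> ?A" "y \<notin> ex_vars \<phi>\<^sub>1" "y \<notin> ex_vars \<phi>\<^sub>2" "D \<inter> ?A = {}" "y \<in> V"
    using E by (auto simp: q_vars_def)
  have y': "y' \<notin> vars \<phi>\<^sub>1" "y' \<notin> vars \<phi>\<^sub>2" "y' \<notin> ?A" "y' \<notin> ex_vars \<phi>\<^sub>1" "y' \<notin> ex_vars \<phi>\<^sub>2"
    using occ by (auto simp: occurs_def vars_def q_vars_def)
  have y'V: "y' \<in> V" using ex_vars_subset[OF R] by auto
  have A: "all_vars ?\<psi> = ?A" "all_vars ?\<chi> = ?A" by auto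
  \<comment> \<open>\<open>D\<close> misses all universal variables, so neither \<open>y\<close> nor
    \<open>y'\<close> contributes anything within \<open>?A\<close>.\<close>
  have dep: "dep ?\<psi> v \<inter> ?A = (dep \<phi>\<^sub>1 v \<union> dep \<phi>\<^sub>2 v) \<inter> ?A"
    "dep ?\<chi> v \<inter> ?A = (dep \<phi>\<^sub>1 v \<union> dep \<phi>\<^sub>2 v) \<inter> ?A" for v
    using y y' by (auto simp: dep_subst dep_eq_empty[of y] dep_eq_empty[of y'] split: if_splits)
  have depy: "dep \<phi>\<^sub>1 y = {}" "dep \<phi>\<^sub>2 y = {}" "dep \<phi>\<^sub>1 y' = {}" "dep \<phi>\<^sub>2 y' = {}"
    using y y' by (auto intro!: dep_eq_empty)
  show "ex_vars ?\<psi> \<subseteq> V - all_vars ?\<psi>" using L by (rule ex_vars_subset)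
  show "ex_vars ?\<chi> \<subseteq> V - all_vars ?\<chi>" using R by (rule ex_vars_subset)
  show "\<exists>T. solves V ?\<chi> T" if S: "solves V ?\<psi> S" for S
  proof -
    have Sb: "S v \<in> boolfuns ((dep \<phi>\<^sub>1 v \<union> dep \<phi>\<^sub>2 v) \<inter> ?A)" if "v \<in> V - ?A" for v
      using S that unfolding solves_def A dep by blast
    have "(S(y' := S y)) v \<in> boolfuns ((dep \<phi>\<^sub>1 v \<union> dep \<phi>\<^sub>2 v) \<inter> ?A)" if "v \<in> V - ?A" for v
      using Sb[of v] Sb[of y] that y by (auto simp: depy)
    moreover have "matrix ?\<chi> (\<lambda>v. if v \<in> V - ?A then (S(y' := S y)) v a else a v)" for a
    proof -
      let ?e = "\<lambda>v. if v \<in> V - ?A then (S(y' := S y)) v a else a v"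
      let ?s = "\<lambda>v. if v \<in> V - ?A then S v a else a v"
      have "matrix \<phi>\<^sub>1 ?e = matrix \<phi>\<^sub>1 ?s" using y' by (intro matrix_cong) auto
      moreover have "matrix \<phi>\<^sub>2 (?e(y := ?e y')) = matrix \<phi>\<^sub>2 ?s"
        using y y' y'V by (intro matrix_cong) auto
      moreover have "matrix \<phi>\<^sub>1 ?s \<or> matrix \<phi>\<^sub>2 ?s" using S unfolding solves_def A by simp
      ultimately show ?thesis by (simp add: matrix_subst)
    qed
    ultimately have "solves V ?\<chi> (S(y' := S y))" unfolding solves_def A dep by blast
    then show ?thesis by blast
  qed
  show "\<exists>S. solves V ?\<psi> S" if T: "solves V ?\<chi> T" for T
  proof -
    have Tb: "T v \<in> boolfuns ((dep \<phi>\<^sub>1 v \<union> dep \<phi>\<^sub>2 v) \<inter> ?A)" if "v \<in> V - ?A" for v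
      using T that unfolding solves_def A dep by blast
    let ?e = "\<lambda>a v. if v \<in> V - ?A then T v a else a v"
    have Tm: "matrix \<phi>\<^sub>1 (?e a) \<or> matrix \<phi>\<^sub>2 ((?e a)(y := T y' a))" for a
      using T y' y'V unfolding solves_def A by (simp add: matrix_subst)
    \<comment> \<open>Locality: the values read by one disjunct are determined by its own universal
      variables, since dependencies on those of the other are forbidden. The pair lets one proof
      cover both disjuncts.\<close>
    have agree: "?e a v = ?e b v"
      if "v \<in> vars \<phi>" "(\<phi>, \<phi>') \<in> {(\<phi>\<^sub>1, \<phi>\<^sub>2), (\<phi>\<^sub>2, \<phi>\<^sub>1)}" "\<And>v. v \<in> all_vars \<phi> \<Longrightarrow> a v = b v"
      for \<phi> \<phi>' v a b
    proof -
      have nq: "v \<notin> q_vars \<phi>'" "dep_vars \<phi> \<inter> all_vars \<phi>' = {}" "v \<in> V"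
        using that C V by (auto simp: q_vars_def)
      have "dep \<phi>' v = {}" using nq by (intro dep_eq_empty) (auto simp: q_vars_def)
      then have "T v \<in> boolfuns (all_vars \<phi>)" if "v \<notin> ?A"
        using Tb[of v] nq that \<open>(\<phi>, \<phi>') \<in> _\<close> dep_subset_dep_vars[of \<phi> v]
        by (auto elim!: boolfuns_mono[rotated])
      moreover have "v \<in> all_vars \<phi>" if "v \<in> ?A"
        using that nq \<open>(\<phi>, \<phi>') \<in> _\<close> by (auto simp: q_vars_def)
      ultimately show ?thesis using that(3) nq(3) by (auto dest: boolfunsD[of _ _ a b])
    qed
    have disj: "all_vars \<phi>\<^sub>1 \<inter> all_vars \<phi>\<^sub>2 = {}" using C by (auto simp: q_vars_def vars_def)
    have const: "T y' a = T y' b" for a b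
      using Tb[of y'] y' y'V by (intro boolfunsD[of "T y'" "{}"]) (auto simp: depy)
    \<comment> \<open>The two disjuncts depend on disjoint sets of universal variables, so one of them is a
      tautology on its own.\<close>
    have "(\<forall>a. matrix \<phi>\<^sub>1 (?e a)) \<or> (\<forall>b. matrix \<phi>\<^sub>2 ((?e b)(y := T y' b)))"
    proof (rule ccontr)
      assume "\<not> ?thesis"
      then obtain a b where ab: "\<not> matrix \<phi>\<^sub>1 (?e a)" "\<not> matrix \<phi>\<^sub>2 ((?e b)(y := T y' b))" by blast
      \<comment> \<open>Gluing the two counterexamples along the disjoint sets of universal
        variables falsifies both disjuncts at once.\<close>
      define c where "c v = (if v \<in> all_vars \<phi>\<^sub>1 then a v else b v)" for v
      have "matrix \<phi>\<^sub>1 (?e c) = matrix \<phi>\<^sub>1 (?e a)"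
        by (rule matrix_cong, rule agree[of _ \<phi>\<^sub>1 \<phi>\<^sub>2]) (auto simp: c_def)
      moreover have "?e c v = ?e b v" if "v \<in> vars \<phi>\<^sub>2" for v
        using that disj by (intro agree[of _ \<phi>\<^sub>2 \<phi>\<^sub>1]) (auto simp: c_def)
      then have "matrix \<phi>\<^sub>2 ((?e c)(y := T y' c)) = matrix \<phi>\<^sub>2 ((?e b)(y := T y' b))"
        using const[of c b] by (intro matrix_cong) auto
      ultimately show False using ab Tm[of c] by blast
    qed
    then show ?thesis
    proof
      assume *: "\<forall>a. matrix \<phi>\<^sub>1 (?e a)"
      have "matrix ?\<psi> (?e a)" for a using * by simp
      then have "solves V ?\<psi> T" using Tb unfolding solves_def A dep by blast
      then show ?thesis by blast
    next
      \<comment> \<open>If the second disjunct survives, \<open>y\<close> takes over the constant of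
        \<open>y'\<close>.\<close>
      assume *: "\<forall>a. matrix \<phi>\<^sub>2 ((?e a)(y := T y' a))"
      have "(?e a)(y := T y' a) = (\<lambda>v. if v \<in> V - ?A then (T(y := T y')) v a else a v)" for a
        using y by (auto simp: fun_eq_iff)
      then have "matrix ?\<psi> (\<lambda>v. if v \<in> V - ?A then (T(y := T y')) v a else a v)" for a
        using * by simp
      moreover have "(T(y := T y')) v \<in> boolfuns ((dep \<phi>\<^sub>1 v \<union> dep \<phi>\<^sub>2 v) \<inter> ?A)" if "v \<in> V - ?A" for v
        using Tb[of v] Tb[of y'] that y' y'V by (auto simp: depy)
      ultimately have "solves V ?\<psi> (T(y := T y'))" unfolding solves_def A dep by blast
      then show ?thesis by blast
    qed
  qed
qed

section \<open>Assembly of the rules, with the rearrangements of the prefix proved directly\<close>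

theorem theorem3:
  fixes V D D1 D2 :: "'v set"
    and \<phi> \<phi>1 \<phi>2 :: "'v dqbf"
    and op :: "'v dqbf \<Rightarrow> 'v dqbf \<Rightarrow> 'v dqbf"
    and x y x' y' x1 x2 y1 y2 :: 'v
  assumes "finite V"
    and "op \<in> {Conj, Disj}"
  shows
    "(Exists y D \<phi> \<in> dqbfs V \<and> \<phi> \<in> dqbfs V
        \<longrightarrow> equivalent V (Exists y D \<phi>) \<phi>)
   \<and> (Forall x \<phi> \<in> dqbfs V \<and> remove_dep x \<phi> \<in> dqbfs V
        \<and> x \<notin> vars \<phi>
        \<longrightarrow> equisatisfiable V (Forall x \<phi>) (remove_dep x \<phi>))
   \<and> (Forall x \<phi> \<in> dqbfs V
        \<and> all_vars \<phi> = {} \<and> ex_vars \<phi> = {}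
        \<longrightarrow> equivalent_common V (Forall x \<phi>)
              (Conj (subst \<phi> (Const False) x) (subst \<phi> (Const True) x)))
   \<and> (Exists y D \<phi> \<in> dqbfs V
        \<and> all_vars \<phi> = {} \<and> ex_vars \<phi> = {}
        \<longrightarrow> equisatisfiable V (Exists y D \<phi>)
              (Disj (subst \<phi> (Const False) y) (subst \<phi> (Const True) y)))
   \<and> (Forall x (Conj \<phi>1 \<phi>2) \<in> dqbfs V
        \<and> Conj (Forall x \<phi>1) (Forall x' (subst \<phi>2 (Var x') x)) \<in> dqbfs V
        \<and> \<not> occurs x' \<phi>1 \<and> \<not> occurs x' \<phi>2
        \<longrightarrow> equisatisfiable V (Forall x (Conj \<phi>1 \<phi>2))
              (Conj (Forall x \<phi>1) (Forall x' (subst \<phi>2 (Var x') x))))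
   \<and> (Forall x (Conj \<phi>1 \<phi>2) \<in> dqbfs V
        \<and> Conj (remove_dep x \<phi>1) (Forall x \<phi>2) \<in> dqbfs V
        \<and> x \<notin> vars \<phi>1
        \<longrightarrow> equisatisfiable V (Forall x (Conj \<phi>1 \<phi>2))
              (Conj (remove_dep x \<phi>1) (Forall x \<phi>2)))
   \<and> (Forall x (op \<phi>1 \<phi>2) \<in> dqbfs V \<and> op \<phi>1 (Forall x \<phi>2) \<in> dqbfs V
        \<and> x \<notin> vars \<phi>1 \<and> (\<forall>z\<in>ex_vars \<phi>1. x \<notin> dep \<phi>1 z)
        \<longrightarrow> equivalent V (Forall x (op \<phi>1 \<phi>2)) (op \<phi>1 (Forall x \<phi>2)))
   \<and> (Exists y D (Disj \<phi>1 \<phi>2) \<in> dqbfs V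
        \<and> Disj (Exists y D \<phi>1) (Exists y' D (subst \<phi>2 (Var y') y)) \<in> dqbfs V
        \<and> \<not> occurs y' \<phi>1 \<and> \<not> occurs y' \<phi>2
        \<longrightarrow> equisatisfiable V (Exists y D (Disj \<phi>1 \<phi>2))
              (Disj (Exists y D \<phi>1) (Exists y' D (subst \<phi>2 (Var y') y))))
   \<and> (Exists y D (op \<phi>1 \<phi>2) \<in> dqbfs V \<and> op \<phi>1 (Exists y D \<phi>2) \<in> dqbfs V
        \<and> y \<notin> vars \<phi>1
        \<longrightarrow> equivalent V (Exists y D (op \<phi>1 \<phi>2)) (op \<phi>1 (Exists y D \<phi>2)))
   \<and> (Exists y1 D1 (Exists y2 D2 \<phi>) \<in> dqbfs V \<and> Exists y2 D2 (Exists y1 D1 \<phi>) \<in> dqbfs V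
        \<longrightarrow> equivalent V (Exists y1 D1 (Exists y2 D2 \<phi>)) (Exists y2 D2 (Exists y1 D1 \<phi>)))
   \<and> (Forall x1 (Forall x2 \<phi>) \<in> dqbfs V \<and> Forall x2 (Forall x1 \<phi>) \<in> dqbfs V
        \<longrightarrow> equivalent V (Forall x1 (Forall x2 \<phi>)) (Forall x2 (Forall x1 \<phi>)))
   \<and> (Forall x (Exists y D \<phi>) \<in> dqbfs V \<and> Exists y D (Forall x \<phi>) \<in> dqbfs V
        \<and> x \<notin> D
        \<longrightarrow> equivalent V (Forall x (Exists y D \<phi>)) (Exists y D (Forall x \<phi>)))"
proof (intro conjI impI; (elim conjE)?)
  assume "Exists y D \<phi> \<in> dqbfs V"
  then show "equivalent V (Exists y D \<phi>) \<phi>" by (rule Exists_equivalent)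
next
  assume "Forall x \<phi> \<in> dqbfs V" "x \<notin> vars \<phi>"
  then show "equisatisfiable V (Forall x \<phi>) (remove_dep x \<phi>)"
    by (rule Forall_equisatisfiable_remove_dep)
next
  assume "Forall x \<phi> \<in> dqbfs V" "all_vars \<phi> = {}" "ex_vars \<phi> = {}"
  then show "equivalent_common V (Forall x \<phi>)
      (Conj (subst \<phi> (Const False) x) (subst \<phi> (Const True) x))"
    by (rule Forall_equivalent_common_expansion[OF Forall_dqbfsD(2)])
next
  assume *: "Exists y D \<phi> \<in> dqbfs V" "all_vars \<phi> = {}" "ex_vars \<phi> = {}"
  then have "fs_vars \<phi> \<subseteq> V" using vars_subset[OF Exists_dqbfsD(1)[OF *(1)]] by (simp add: vars_def)
  with * show "equisatisfiable V (Exists y D \<phi>)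
      (Disj (subst \<phi> (Const False) y) (subst \<phi> (Const True) y))"
    by (intro Exists_equisatisfiable_expansion[OF Exists_dqbfsD(2)])
next
  assume "Forall x (Conj \<phi>1 \<phi>2) \<in> dqbfs V"
    "Conj (Forall x \<phi>1) (Forall x' (subst \<phi>2 (Var x') x)) \<in> dqbfs V"
    "\<not> occurs x' \<phi>1" "\<not> occurs x' \<phi>2"
  then show "equisatisfiable V (Forall x (Conj \<phi>1 \<phi>2))
      (Conj (Forall x \<phi>1) (Forall x' (subst \<phi>2 (Var x') x)))"
    by (rule Forall_Conj_rename_equisatisfiable)
next
  assume "Forall x (Conj \<phi>1 \<phi>2) \<in> dqbfs V" "Conj (remove_dep x \<phi>1) (Forall x \<phi>2) \<in> dqbfs V"
    "x \<notin> vars \<phi>1"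
  then show "equisatisfiable V (Forall x (Conj \<phi>1 \<phi>2)) (Conj (remove_dep x \<phi>1) (Forall x \<phi>2))"
    by (rule Forall_Conj_left_equisatisfiable)
next
  show "equivalent V (Forall x (op \<phi>1 \<phi>2)) (op \<phi>1 (Forall x \<phi>2))"
    using assms(2) by (intro equivalentI) (auto simp: fun_eq_iff)
next
  assume "Exists y D (Disj \<phi>1 \<phi>2) \<in> dqbfs V"
    "Disj (Exists y D \<phi>1) (Exists y' D (subst \<phi>2 (Var y') y)) \<in> dqbfs V"
    "\<not> occurs y' \<phi>1" "\<not> occurs y' \<phi>2"
  then show "equisatisfiable V (Exists y D (Disj \<phi>1 \<phi>2))
      (Disj (Exists y D \<phi>1) (Exists y' D (subst \<phi>2 (Var y') y)))"
    by (rule Exists_Disj_rename_equisatisfiable)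
next
  assume "y \<notin> vars \<phi>1"
  \<comment> \<open>The dependency set of \<open>y\<close> is \<open>D\<close> on the left but
    \<open>dep \<phi>1 y \<union> D\<close> on the right.\<close>
  then have "dep \<phi>1 y = {}" by (intro dep_eq_empty) (auto simp: vars_def q_vars_def)
  then show "equivalent V (Exists y D (op \<phi>1 \<phi>2)) (op \<phi>1 (Exists y D \<phi>2))"
    using assms(2) by (intro equivalentI) (auto simp: fun_eq_iff)
next
  assume "Exists y1 D1 (Exists y2 D2 \<phi>) \<in> dqbfs V"
  \<comment> \<open>Were the variables equal, the outer set would win on each side, giving
    \<open>D1\<close> against \<open>D2\<close>.\<close>
  from Exists_dqbfsD(3)[OF this] have "y1 \<noteq> y2" by (simp add: q_vars_def)
  then show "equivalent V (Exists y1 D1 (Exists y2 D2 \<phi>)) (Exists y2 D2 (Exists y1 D1 \<phi>))"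
    by (intro equivalentI) (auto simp: fun_eq_iff)
next
  show "equivalent V (Forall x1 (Forall x2 \<phi>)) (Forall x2 (Forall x1 \<phi>))"
    by (intro equivalentI) (auto simp: fun_eq_iff)
next
  show "equivalent V (Forall x (Exists y D \<phi>)) (Exists y D (Forall x \<phi>))"
    by (intro equivalentI) (auto simp: fun_eq_iff)
qed

end
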